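(* Let $d\geq1$, $n\ge0$, and let $\sigma$ be a legal word with stack $\mathcal S(\sigma)=(I_1,\ldots,I_s)$. (a) The word $\sigma$ avoids $\beta_d$. (b) If reading the unread letter $x$ from $\sigma$ is illegal, then no $\beta_d$-avoiding permutation of $[n]$ has the prefix $\sigma x$. (c) A word is legal if and only if it is a prefix of a $\beta_d$-avoiding permutation of $[n]$. In particular $\mathrm{Av}_n(\beta_d)$ is the set of legal permutations of $[n]$.
   Context: Write $[n]=\{1,\ldots,n\}$. A word with distinct entries contains a permutation $\tau$ of $[k]$ if it has a subsequence of length $k$ in the same relative order as $\tau$; otherwise it avoids $\tau$. $\mathrm{Av}_n(\tau)$ is the set of $\tau$-avoiding permutations of $[n]$. For $d\ge1$, $\beta_d=12\cdots d\,(d+2)(d+3)(d+1)$, a permutation of $[d+3]$. A $d$-trigger of a word with distinct letters is the last entry of an increasing subsequence of length $d$ (positions need not be adjacent). Fix $d$ and $n$. A scan state is a pair $(\sigma,S)$. Here $\sigma$ is a word with distinct letters from $[n]$ (the read prefix); letters of $[n]$ not in $\sigma$ are unread. Let $q$ be the least $d$-trigger of $\sigma$, and $q=n+d$ (a virtual value above every letter) if $\sigma$ has no $d$-trigger. The stack $S=(I_1,\ldots,I_s)$ is a list of nonempty sets with $I_1<I_2<\cdots<I_s$ (all elements of $I_j$ smaller than all elements of $I_{j+1}$) whose union is the set of unread letters larger than $q$. The initial state is $(\varepsilon,\varnothing)$ (empty prefix, empty stack). For an unread letter $x$, reading $x$ is a legal move, leading to $(\sigma x,S')$, in the following three cases.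 - Merger: $x$ is a $d$-trigger of $\sigma x$ and $x<q$. Let $E$ be the set of unread letters strictly between $x$ and $q$. Then $S'=(E\cup I_1,I_2,\ldots,I_s)$, where $I_1=\varnothing$ if $s=0$, with an empty set deleted. - Split: $x$ is a $d$-trigger of $\sigma x$, $x>q$, and $x\in I_1$. Then $S'=(I_1^{<x},I_1^{>x},I_2,\ldots,I_s)$, where $I_1^{<x},I_1^{>x}$ are the sets of elements of $I_1$ below and above $x$, with empty sets deleted. - Non-trigger move: $x$ is not a $d$-trigger of $\sigma x$. Then $S'=S$. Reading any other unread letter is illegal. (A legal move from a scan state leads to a scan state.) A word $\sigma$ is legal if the initial state reaches a state $(\sigma,S)$ by legal moves; then $S$ is determined by $\sigma$ and denoted $\mathcal S(\sigma)$. *)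

theory Defs
  imports "HOL-Library.Sublist" "HOL-Combinatorics.Multiset_Permutations"
begin

text \<open>Words, and permutations of $[n]$ in one-line notation, are lists of natural numbers;
  the permutations of $[n]$ are the members of \<^term>\<open>permutations_of_set {1..n::nat}\<close>.\<close>

definition same_relative_order :: "nat list \<Rightarrow> nat list \<Rightarrow> bool" where
  "same_relative_order u v \<longleftrightarrow> length u = length v \<and>
     (\<forall>i<length u. \<forall>j<length u. u ! i < u ! j \<longleftrightarrow> v ! i < v ! j)"

definition contains :: "nat list \<Rightarrow> nat list \<Rightarrow> bool" where
  "contains w \<tau> \<longleftrightarrow> (\<exists>u. subseq u w \<and> same_relative_order u \<tau>)"

definition avoids :: "nat list \<Rightarrow> nat list \<Rightarrow> bool" where
  "avoids w \<tau> \<longleftrightarrow> \<not> contains w \<tau>"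

definition Av :: "nat \<Rightarrow> nat list \<Rightarrow> nat list set" where
  "Av n \<tau> = {\<pi> \<in> permutations_of_set {1..n}. avoids \<pi> \<tau>}"

definition beta :: "nat \<Rightarrow> nat list" where
  "beta d = [1..<d + 1] @ [d + 2, d + 3, d + 1]"

definition trigger :: "nat \<Rightarrow> nat list \<Rightarrow> nat \<Rightarrow> bool" where
  "trigger d w x \<longleftrightarrow>
     (\<exists>u. subseq u w \<and> length u = d \<and> sorted_wrt (<) u \<and> u \<noteq> [] \<and> last u = x)"

definition least_trigger :: "nat \<Rightarrow> nat \<Rightarrow> nat list \<Rightarrow> nat" where
  "least_trigger d n \<sigma> =
     (if \<exists>x. trigger d \<sigma> x then (LEAST x. trigger d \<sigma> x) else n + d)"

definition unread :: "nat \<Rightarrow> nat list \<Rightarrow> nat set" where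
  "unread n \<sigma> = {1..n} - set \<sigma>"

type_synonym stack = "nat set list"

definition scan_state :: "nat \<Rightarrow> nat \<Rightarrow> nat list \<times> stack \<Rightarrow> bool" where
  "scan_state d n = (\<lambda>(\<sigma>, S).
     distinct \<sigma> \<and> set \<sigma> \<subseteq> {1..n} \<and>
     (\<forall>I\<in>set S. I \<noteq> {}) \<and>
     sorted_wrt (\<lambda>I J. \<forall>a\<in>I. \<forall>b\<in>J. a < b) S \<and>
     \<Union> (set S) = {y \<in> unread n \<sigma>. y > least_trigger d n \<sigma>})"

definition first_set :: "stack \<Rightarrow> nat set" where
  "first_set S = (case S of [] \<Rightarrow> {} | I # _ \<Rightarrow> I)"

definition delete_empty :: "stack \<Rightarrow> stack" where
  "delete_empty S = filter (\<lambda>I. I \<noteq> {}) S"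

inductive legal_move :: "nat \<Rightarrow> nat \<Rightarrow> nat \<Rightarrow> nat list \<times> stack \<Rightarrow> nat list \<times> stack \<Rightarrow> bool"
  for d n x where
  merger: "\<lbrakk> scan_state d n (\<sigma>, S); x \<in> unread n \<sigma>;
      trigger d (\<sigma> @ [x]) x; x < least_trigger d n \<sigma>;
      E = {y \<in> unread n \<sigma>. x < y \<and> y < least_trigger d n \<sigma>} \<rbrakk>
    \<Longrightarrow> legal_move d n x (\<sigma>, S) (\<sigma> @ [x], delete_empty ((E \<union> first_set S) # tl S))"
| split: "\<lbrakk> scan_state d n (\<sigma>, S); x \<in> unread n \<sigma>;
      trigger d (\<sigma> @ [x]) x; x > least_trigger d n \<sigma>; S = I # T; x \<in> I \<rbrakk>
    \<Longrightarrow> legal_move d n x (\<sigma>, S)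
          (\<sigma> @ [x], delete_empty ({y \<in> I. y < x} # {y \<in> I. y > x} # T))"
| non_trigger: "\<lbrakk> scan_state d n (\<sigma>, S); x \<in> unread n \<sigma>; \<not> trigger d (\<sigma> @ [x]) x \<rbrakk>
    \<Longrightarrow> legal_move d n x (\<sigma>, S) (\<sigma> @ [x], S)"

definition legal_read :: "nat \<Rightarrow> nat \<Rightarrow> nat list \<times> stack \<Rightarrow> nat \<Rightarrow> bool" where
  "legal_read d n s x \<longleftrightarrow> (\<exists>s'. legal_move d n x s s')"

definition reachable :: "nat \<Rightarrow> nat \<Rightarrow> nat list \<times> stack \<Rightarrow> bool" where
  "reachable d n s \<longleftrightarrow> (\<lambda>s s'. \<exists>x. legal_move d n x s s')\<^sup>*\<^sup>* ([], []) s"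

definition legal_word :: "nat \<Rightarrow> nat \<Rightarrow> nat list \<Rightarrow> bool" where
  "legal_word d n \<sigma> \<longleftrightarrow> (\<exists>S. reachable d n (\<sigma>, S))"

text \<open>The description in \<open>stack_of\<close> is proper for legal words by \<open>reachable_unique\<close> below.\<close>

definition stack_of :: "nat \<Rightarrow> nat \<Rightarrow> nat list \<Rightarrow> stack" where
  "stack_of d n \<sigma> = (THE S. reachable d n (\<sigma>, S))"

lemma legal_move_deterministic:
  assumes "legal_move d n x s t" "legal_move d n x s t'"
  shows "t = t'"
  using assms by (auto elim!: legal_move.cases)

lemma legal_move_word:
  assumes "legal_move d n x s t"
  shows "fst t = fst s @ [x]"
  using assms by (auto elim!: legal_move.cases)

lemma reachable_cases:
  assumes "reachable d n t"
  obtains "t = ([], [])" | s x where "reachable d n s" "legal_move d n x s t"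
  using assms unfolding reachable_def by (auto elim: rtranclp.cases)

lemma reachable_unique:
  assumes "reachable d n (\<sigma>, S)" "reachable d n (\<sigma>, T)"
  shows "S = T"
  using assms
proof (induction \<sigma> arbitrary: S T rule: rev_induct)
  case Nil
  have "U = []" if "reachable d n ([], U)" for U
    using that by (cases rule: reachable_cases) (auto dest: legal_move_word)
  with Nil show ?case by blast
next
  case (snoc x \<sigma>)
  have *: "\<exists>V. reachable d n (\<sigma>, V) \<and> legal_move d n x (\<sigma>, V) (\<sigma> @ [x], U)"
    if "reachable d n (\<sigma> @ [x], U)" for U
    using that
  proof (cases rule: reachable_cases)
    case (2 s y)
    with legal_move_word[OF 2(2)] show ?thesis by (cases s) auto
  qed simp
  from *[OF snoc.prems(1)] *[OF snoc.prems(2)] snoc.IH show ?case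
    by (metis legal_move_deterministic prod.inject)
qed

corollary stack_of_eq:
  assumes "reachable d n (\<sigma>, S)"
  shows "stack_of d n \<sigma> = S"
  unfolding stack_of_def using assms reachable_unique by blast

end

theory Submission
  imports Defs
begin

text \<open>
An occurrence of the pattern consists of an increasing word of length $d$ with last letter $a$,
followed by three letters $b$, $c$, $y$ with $a < y < b < c$ (\<open>contains_beta_iff\<close>). So after
$a$ and $b$ have been read, an unread letter $y$ with $a < y < b$ forbids every $x > b$ from being
read before $y$. The stack records exactly these prohibitions, in the following sense.

\<^item> Two letters of one block have never been separated by such a pair $a$, $b$. Hence reading a
  letter $c$ of the first block cannot create a pattern that awaits its last letter: the missing
  $y < c$ would be larger than the least trigger, so it would be in the first block too, and $b$
  would separate $y$ from $c$ inside that block.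

\<^item> For any two blocks $I$ before $J$, some pair $a$, $b$ has $I < b < J$, and $a < y$ for at
  least one $y$ in $I$. Hence a letter $x$ of a later block is forbidden as long as that $y$ in
  the first block is unread: $a$, $b$, $x$, $y$ would complete a pattern.

Together with pattern avoidance and the absence of an unread letter that completes a pattern, these
two properties form the invariant \<open>scan_invariant\<close>. It holds in every reachable state
(\<open>reachable_scan_invariant\<close>) because every trigger is at or above the least one: a
letter read below the least trigger takes none of the roles $b$, $c$, $y$, and a letter read
above it acts as a new $b$, at which the first block is cut.

Part (a) is a clause of the invariant, and (b) is the second property above
(\<open>illegal_read_blocks\<close>). For (c), a letter of the first block can always be read, and if the
stack is empty then every unread letter can be read. So a legal word extends to a legal permutation,
which avoids the pattern by (a); conversely, by (b) every letter of an avoiding permutation is read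
legally.
\<close>

section \<open>Triggers and what follows them\<close>

text \<open>A pattern is built up one letter at a time, so all of its stages are needed: the trigger
alone, and the trigger followed by one, two or three letters. Keeping the tail \<open>vs\<close> arbitrary
treats them together, and appending a letter to the word then has a single recursion rule.\<close>

definition trigger_followed_by :: "nat \<Rightarrow> nat list \<Rightarrow> nat \<Rightarrow> nat list \<Rightarrow> bool" where
  "trigger_followed_by d w a vs \<longleftrightarrow>
     (\<exists>u. subseq (u @ vs) w \<and> length u = d \<and> sorted_wrt (<) u \<and> u \<noteq> [] \<and> last u = a)"

lemma trigger_iff_followed_by_Nil: "trigger d w a \<longleftrightarrow> trigger_followed_by d w a []"
  by (simp add: trigger_def trigger_followed_by_def)

lemma subseq_snoc_snoc_iff:
  "subseq (us @ [y]) (ws @ [x]) \<longleftrightarrow> subseq (us @ [y]) ws \<or> y = x \<and> subseq us ws"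
proof
  assume "subseq (us @ [y]) (ws @ [x])"
  then obtain as bs where *: "us @ [y] = as @ bs" "subseq as ws" "subseq bs [x]"
    by (rule subseq_appendE)
  show "subseq (us @ [y]) ws \<or> y = x \<and> subseq us ws"
  proof (cases bs rule: rev_cases)
    case Nil
    with * show ?thesis by simp
  next
    case (snoc cs z)
    then have "cs = []" "z = x"
      using *(3) list_emb_length[OF *(3)] list_emb_set[OF *(3)] by auto
    with * snoc show ?thesis by simp
  qed
qed (auto simp: subseq_rev_drop_many)

lemma followed_by_snoc_iff:
  "trigger_followed_by d (w @ [x]) a (vs @ [y]) \<longleftrightarrow>
     trigger_followed_by d w a (vs @ [y]) \<or> y = x \<and> trigger_followed_by d w a vs"
  unfolding trigger_followed_by_def append_assoc[symmetric] subseq_snoc_snoc_iff by blast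

lemmas followed_by_one_snoc_iff = followed_by_snoc_iff[where vs = "[]", simplified]
  and followed_by_two_snoc_iff = followed_by_snoc_iff[where vs = "[v]" for v, simplified]
  and followed_by_three_snoc_iff = followed_by_snoc_iff[where vs = "[v, v']" for v v', simplified]

lemma followed_by_mono:
  assumes "trigger_followed_by d w a vs" "subseq vs' vs" "subseq w w'"
  shows "trigger_followed_by d w' a vs'"
proof -
  have "subseq (u @ vs') w'" if "subseq (u @ vs) w" for u
  proof -
    have "subseq (u @ vs') (u @ vs)" using assms(2) by (simp add: subseq_append')
    then show ?thesis using that assms(3) by (blast intro: subseq_order.trans)
  qed
  with assms(1) show ?thesis unfolding trigger_followed_by_def by blast
qed

lemma followed_by_imp_trigger: "trigger_followed_by d w a vs \<Longrightarrow> trigger d w a"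
  using followed_by_mono[of d w a vs "[]" w] by (simp add: trigger_iff_followed_by_Nil)

lemma followed_by_append:
  assumes "trigger_followed_by d w a vs" "subseq vs' w'"
  shows "trigger_followed_by d (w @ w') a (vs @ vs')"
proof -
  obtain u where "subseq (u @ vs) w" "length u = d \<and> sorted_wrt (<) u \<and> u \<noteq> [] \<and> last u = a"
    using assms(1) unfolding trigger_followed_by_def by blast
  then show ?thesis
    using list_emb_append_mono[OF _ assms(2), of "u @ vs" w] unfolding trigger_followed_by_def
    by auto
qed

lemma not_followed_by_Nil: "\<not> trigger_followed_by d [] a vs"
  by (auto simp: trigger_followed_by_def)

lemma trigger_snoc_iff:
  "trigger d (w @ [x]) y \<longleftrightarrow> trigger d w y \<or> y = x \<and> trigger d (w @ [x]) x"
proof -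
  have "trigger d w y \<or> y = x" if new: "trigger d (w @ [x]) y"
  proof -
    obtain u where u: "subseq u (w @ [x])" "length u = d" "sorted_wrt (<) u" "u \<noteq> []" "last u = y"
      using new unfolding trigger_def by blast
    from u(4,5) have "u = butlast u @ [y]" by auto
    with u(1) have "subseq u w \<or> y = x" using subseq_snoc_snoc_iff by metis
    with u show ?thesis unfolding trigger_def by blast
  qed
  moreover have "trigger d (w @ [x]) y" if old: "trigger d w y"
    unfolding trigger_iff_followed_by_Nil
    by (rule followed_by_mono[OF old[unfolded trigger_iff_followed_by_Nil]])
      (simp_all add: subseq_rev_drop_many)
  ultimately show ?thesis by blast
qed

text \<open>Append \<open>x\<close> to the increasing word that ends in \<open>a\<close> and drop its first letter to
restore the length. So an unread letter above the least trigger is a trigger as soon as it is read,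
and only letters below it can be non-triggers.\<close>

lemma trigger_greater:
  assumes "trigger d w a" "a < x"
  shows "trigger d (w @ [x]) x"
proof -
  obtain u where u: "subseq u w" "length u = d" "sorted_wrt (<) u" "u \<noteq> []" "last u = a"
    using assms(1) unfolding trigger_def by blast
  obtain v where v: "u = v @ [a]" using u by (metis append_butlast_last_id)
  have s: "sorted_wrt (<) (u @ [x])"
    using u(3) assms(2) unfolding v by (auto simp: sorted_wrt_append)
  have "subseq (u @ [x]) (w @ [x])" using u(1) by (simp add: subseq_snoc_snoc_iff)
  then have "subseq (tl (u @ [x])) (w @ [x])"
    by (metis subseq_Cons' u(4) append_is_Nil_conv list.collapse)
  moreover have "sorted_wrt (<) (tl (u @ [x]))" using s by (cases u) auto
  ultimately show ?thesis unfolding trigger_def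
    using u by (intro exI[of _ "tl (u @ [x])"]) auto
qed

lemma trigger_in_set: "trigger d w a \<Longrightarrow> a \<in> set w"
  unfolding trigger_def using list_emb_set[OF _ last_in_set, of "(=)" _ w] by blast

lemma least_trigger_le: "trigger d w a \<Longrightarrow> least_trigger d n w \<le> a"
  by (auto simp: least_trigger_def intro: Least_le)

lemma trigger_least_trigger:
  assumes "least_trigger d n w < n + d"
  shows "trigger d w (least_trigger d n w)"
  using assms LeastI_ex[of "trigger d w"] unfolding least_trigger_def by presburger

text \<open>The virtual value \<^term>\<open>n + d\<close> is above every letter because
\<^term>\<open>d \<ge> 1\<close>; any other value is a letter of \<open>w\<close>.\<close>

lemma least_trigger_read:
  assumes "d \<ge> 1"
  shows "least_trigger d n w \<notin> unread n w"
proof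
  assume q: "least_trigger d n w \<in> unread n w"
  then have "least_trigger d n w < n + d" using assms by (auto simp: unread_def)
  from trigger_in_set[OF trigger_least_trigger[OF this]] q show False
    by (simp add: unread_def)
qed

lemma least_trigger_snoc:
  assumes "x < n + d"
  shows "least_trigger d n (w @ [x]) =
     (if trigger d (w @ [x]) x \<and> x < least_trigger d n w then x else least_trigger d n w)"
proof (cases "trigger d (w @ [x]) x")
  case False
  then have "trigger d (w @ [x]) = trigger d w"
    using trigger_snoc_iff by blast
  then show ?thesis using False by (simp add: least_trigger_def)
next
  case new: True
  let ?q = "least_trigger d n w"
  have iff: "trigger d (w @ [x]) y \<longleftrightarrow> trigger d w y \<or> y = x" for y
    using new trigger_snoc_iff[of d w x y] by blast
  have "(LEAST a. trigger d (w @ [x]) a) = min x ?q"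
  proof (rule Least_equality)
    show "trigger d (w @ [x]) (min x ?q)"
      using trigger_least_trigger[of d n w] assms by (auto simp: iff min_def)
    show "min x ?q \<le> a" if "trigger d (w @ [x]) a" for a
      using that least_trigger_le[of d w a n] by (auto simp: iff)
  qed
  then show ?thesis using new by (auto simp: least_trigger_def[of d n "w @ [x]"] min_def)
qed

section \<open>Occurrences of the pattern\<close>

lemma nth_beta:
  "length (beta d) = d + 3" "i < d \<Longrightarrow> beta d ! i = i + 1"
  "beta d ! d = d + 2" "beta d ! (Suc d) = d + 3" "beta d ! (Suc (Suc d)) = d + 1"
  unfolding beta_def by (simp_all add: nth_append del: upt_Suc)

lemma contains_beta_iff:
  assumes "d \<ge> 1"
  shows "contains w (beta d) \<longleftrightarrow>
    (\<exists>a y b c. trigger_followed_by d w a [b, c, y] \<and> a < y \<and> y < b \<and> b < c)"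
proof
  assume "contains w (beta d)"
  then obtain u where u: "subseq u w" "length u = d + 3"
    and ord: "\<And>i j. i < d + 3 \<Longrightarrow> j < d + 3 \<Longrightarrow> u ! i < u ! j \<longleftrightarrow> beta d ! i < beta d ! j"
    by (auto simp: contains_def same_relative_order_def nth_beta)
  define v where "v = take d u"
  have "drop d u = [u ! d, u ! Suc d, u ! Suc (Suc d)]"
    using u(2) Cons_nth_drop_Suc[of d u] Cons_nth_drop_Suc[of "Suc d" u]
      Cons_nth_drop_Suc[of "Suc (Suc d)" u] by simp
  then have uv: "u = v @ [u ! d, u ! Suc d, u ! Suc (Suc d)]"
    unfolding v_def by (metis append_take_drop_id)
  have "sorted_wrt (<) v"
    by (auto simp: v_def sorted_wrt_iff_nth_less ord nth_beta u)
  moreover have "length v = d" "v \<noteq> []" using u assms by (auto simp: v_def)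
  moreover from this have "last v = u ! (d - 1)" using assms by (simp add: last_conv_nth v_def)
  ultimately have "trigger_followed_by d w (u ! (d - 1)) [u ! d, u ! Suc d, u ! Suc (Suc d)]"
    using u(1) uv unfolding trigger_followed_by_def by metis
  moreover have "u ! (d - 1) < u ! Suc (Suc d)" "u ! Suc (Suc d) < u ! d" "u ! d < u ! Suc d"
    using assms by (auto simp: ord nth_beta)
  ultimately show "\<exists>a y b c. trigger_followed_by d w a [b, c, y] \<and> a < y \<and> y < b \<and> b < c"
    by blast
next
  assume "\<exists>a y b c. trigger_followed_by d w a [b, c, y] \<and> a < y \<and> y < b \<and> b < c"
  then obtain a y b c v where v: "subseq (v @ [b, c, y]) w" "length v = d" "sorted_wrt (<) v"
    "v \<noteq> []" "last v = a" and less: "a < y" "y < b" "b < c"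
    unfolding trigger_followed_by_def by blast
  have le: "v ! i \<le> a" if "i < d" for i
  proof (cases "i = d - 1")
    case True
    then show ?thesis using v by (simp add: last_conv_nth)
  next
    case False
    then have "v ! i < v ! (d - 1)" using that v(2) by (intro sorted_wrt_nth_less[OF v(3)]) auto
    then show ?thesis using v by (simp add: last_conv_nth)
  qed
  have mono: "v ! i < v ! j \<longleftrightarrow> i < j" if "i < d" "j < d" for i j
    using that sorted_wrt_nth_less[OF v(3), of i j] sorted_wrt_nth_less[OF v(3), of j i] v(2)
    by (cases i j rule: linorder_cases) auto
  let ?u = "v @ [b, c, y]"
  have u: "?u ! d = b" "?u ! Suc d = c" "?u ! Suc (Suc d) = y" "\<And>i. i < d \<Longrightarrow> ?u ! i = v ! i"
    using v(2) by (auto simp: nth_append)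
  have "?u ! i < ?u ! j \<longleftrightarrow> beta d ! i < beta d ! j" if "i < d + 3" "j < d + 3" for i j
  proof -
    have ind: "k < d \<or> k = d \<or> k = Suc d \<or> k = Suc (Suc d)" if "k < d + 3" for k
      using that by auto
    have lt: "v ! k < y" "v ! k < b" "v ! k < c" "\<not> y < v ! k" "\<not> b < v ! k" "\<not> c < v ! k"
      if "k < d" for k
      using le[OF that] less by auto
    show ?thesis
      using ind[OF that(1)] ind[OF that(2)] less
      by (elim disjE; simp add: u nth_beta mono lt del: nth_append_length)
  qed
  then have "same_relative_order ?u (beta d)"
    using v(2) by (auto simp: same_relative_order_def nth_beta)
  with v(1) show "contains w (beta d)" unfolding contains_def by blast
qed

section \<open>The invariant of scan states\<close>

lemma scan_stateD:
  assumes "scan_state d n (w, S)"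
  shows "distinct w" "set w \<subseteq> {1..n}" "\<And>I. I \<in> set S \<Longrightarrow> I \<noteq> {}"
    and "sorted_wrt (\<lambda>I J. \<forall>a\<in>I. \<forall>b\<in>J. a < b) S"
    and "\<Union> (set S) = {y \<in> unread n w. y > least_trigger d n w}"
  using assms unfolding scan_state_def by auto

lemma unread_snoc: "unread n (w @ [x]) = unread n w - {x}"
  by (auto simp: unread_def)

lemma set_delete_empty: "set (delete_empty S) = set S - {{}}"
  by (auto simp: delete_empty_def)

lemma Union_delete_empty: "\<Union> (set (delete_empty S)) = \<Union> (set S)"
  by (auto simp: delete_empty_def)

lemma sorted_wrt_delete_empty:
  "sorted_wrt (\<lambda>I J. I \<noteq> {} \<longrightarrow> P I J) S \<Longrightarrow> sorted_wrt P (delete_empty S)"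
  by (induction S) (auto simp: delete_empty_def)

text \<open>Only one \<open>y\<close> in \<open>I\<close> is required to lie above \<open>a\<close>: a merger adds
letters below the least trigger to the first block, and no trigger read earlier is below those.
On the other hand all of \<open>I\<close> must lie below \<open>b\<close>, so that after a split the upper
part of \<open>I\<close>, whatever letters it has, is still separated from the later blocks.\<close>

definition separated :: "nat \<Rightarrow> nat list \<Rightarrow> nat set \<Rightarrow> nat set \<Rightarrow> bool" where
  "separated d w I J \<longleftrightarrow> (\<exists>a b. trigger_followed_by d w a [b] \<and>
     (\<exists>y\<in>I. a < y) \<and> (\<forall>y\<in>I. y < b) \<and> (\<forall>z\<in>J. b < z))"

lemma separated_snoc: "separated d w I J \<Longrightarrow> separated d (w @ [x]) I J"
  unfolding separated_def by (auto simp: followed_by_one_snoc_iff)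

text \<open>Three stages of an occurrence: the pattern is complete, only its last letter is missing, or
both of its last two letters \<open>z\<close>, \<open>y\<close> are missing. In the last case the two letters must not share a block,
since nothing prevents the larger letter of the first block from being read before the smaller.\<close>

locale scan_invariant =
  fixes d n :: nat and w :: "nat list" and S :: stack
  assumes state: "scan_state d n (w, S)"
    and pattern_free: "\<lbrakk>trigger_followed_by d w a [b, c, y]; a < y; y < b; b < c\<rbrakk> \<Longrightarrow> False"
    and unread_completes_no_pattern:
      "\<lbrakk>y \<in> unread n w; trigger_followed_by d w a [b, c]; a < y; y < b; b < c\<rbrakk> \<Longrightarrow> False"
    and block_not_separated:
      "\<lbrakk>I \<in> set S; y \<in> I; z \<in> I; trigger_followed_by d w a [b]; a < y; y < b; b < z\<rbrakk> \<Longrightarrow> False"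
    and blocks_separated: "sorted_wrt (separated d w) S"

lemma scan_invariant_Nil: "scan_invariant d n [] []"
  by unfold_locales
    (auto simp: scan_state_def not_followed_by_Nil unread_def least_trigger_def
      trigger_iff_followed_by_Nil)

text \<open>The common part of mergers and non-trigger moves. The letter read lies below every trigger
of \<open>w\<close>, whereas the letters \<open>b\<close>, \<open>c\<close> and \<open>y\<close> of an occurrence lie above the
trigger \<open>a\<close>. So it takes none of these roles, and no
occurrence that already has its trigger makes progress.\<close>

lemma scan_invariant_below_least_trigger:
  assumes "scan_invariant d n w S" "x \<in> unread n w" "x < least_trigger d n w"
    and state: "scan_state d n (w @ [x], S')"
    and blocks: "\<And>I y z a b. \<lbrakk>I \<in> set S'; y \<in> I; z \<in> I; trigger_followed_by d w a [b]; a < y; y < b; b < z\<rbrakk> \<Longrightarrow> False"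
    and sep: "sorted_wrt (separated d w) S'"
  shows "scan_invariant d n (w @ [x]) S'"
proof -
  have le: "x < a" if "trigger_followed_by d w a vs" for a vs
    using followed_by_imp_trigger[OF that] least_trigger_le[of d w a n] assms(3) by simp
  show ?thesis
  proof
    fix a y b c
    assume "trigger_followed_by d (w @ [x]) a [b, c, y]" "a < y" "y < b" "b < c"
    then show False
      unfolding followed_by_three_snoc_iff
      using scan_invariant.pattern_free[OF assms(1)] le less_asym by metis
  next
    fix a y b c
    assume "y \<in> unread n (w @ [x])"
      and "trigger_followed_by d (w @ [x]) a [b, c]" "a < y" "y < b" "b < c"
    then show False
      unfolding followed_by_two_snoc_iff unread_snoc
      using scan_invariant.unread_completes_no_pattern[OF assms(1)] le[of a "[b]"] by fastforce
  next
    fix I y z a b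
    assume "I \<in> set S'" "y \<in> I" "z \<in> I"
      and "trigger_followed_by d (w @ [x]) a [b]" "a < y" "y < b" "b < z"
    then show False
      unfolding followed_by_one_snoc_iff using blocks le[of a "[]"] by fastforce
  next
    show "sorted_wrt (separated d (w @ [x])) S'"
      using sep by (rule sorted_wrt_mono_rel[rotated]) (simp add: separated_snoc)
  qed (rule state)
qed

text \<open>A letter of \<open>E\<close> is below every trigger of \<open>w\<close>, so no pair \<open>a\<close>, \<open>b\<close>
separates it from anything, and it can join the first block without harm.\<close>

lemma scan_invariant_merger:
  assumes inv: "scan_invariant d n w S" and d: "d \<ge> 1" and x: "x \<in> unread n w"
    and trig: "trigger d (w @ [x]) x" and less: "x < least_trigger d n w"
  defines "E \<equiv> {y \<in> unread n w. x < y \<and> y < least_trigger d n w}"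
  shows "scan_invariant d n (w @ [x]) (delete_empty ((E \<union> first_set S) # tl S))"
proof -
  let ?q = "least_trigger d n w"
  \<comment> \<open>An empty stack is treated as if it had the single block \<open>{}\<close>.\<close>
  define I T where "I = first_set S" and "T = tl S"
  note state = scan_stateD[OF scan_invariant.state[OF inv]]
  have sorted_IT: "sorted_wrt R (I # T)" if "sorted_wrt R S" for R
    using that by (cases S) (auto simp: I_def T_def first_set_def)
  have IT: "I \<in> set S \<or> I = {} \<and> T = []" "set T \<subseteq> set S" "\<Union> (set S) = I \<union> \<Union> (set T)"
    by (cases S; auto simp: I_def T_def first_set_def)+
  have "x \<le> n" using x by (simp add: unread_def)
  then have q: "least_trigger d n (w @ [x]) = x"
    using trig less d by (simp add: least_trigger_snoc)
  have q_le: "?q \<le> a" if "trigger_followed_by d w a vs" for a vs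
    using followed_by_imp_trigger[OF that] least_trigger_le by blast
  have above: "?q < y" if "J \<in> set S" "y \<in> J" for J y
    using that state(5) by blast
  have E_less: "y < ?q" if "y \<in> E" for y using that by (simp add: E_def)
  show ?thesis
    unfolding I_def[symmetric] T_def[symmetric]
  proof (rule scan_invariant_below_least_trigger[OF inv x less])
    have "y < z" if "y \<in> E" "J \<in> set T" "z \<in> J" for y z J
      using E_less[OF that(1)] above[OF _ that(3)] that(2) IT(2) by fastforce
    then have "sorted_wrt (\<lambda>I J. \<forall>a\<in>I. \<forall>b\<in>J. a < b) ((E \<union> I) # T)"
      using sorted_IT[OF state(4)] by auto
    then have "sorted_wrt (\<lambda>I J. \<forall>a\<in>I. \<forall>b\<in>J. a < b) (delete_empty ((E \<union> I) # T))"
      unfolding delete_empty_def by (rule sorted_wrt_filter)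
    moreover have "E \<union> I \<union> \<Union> (set T) = {y \<in> unread n (w @ [x]). x < y}"
    proof -
      have "E \<union> {y \<in> unread n w. ?q < y} = {y \<in> unread n w. x < y}"
        using less least_trigger_read[OF d, of n w] by (auto simp: E_def not_less le_less)
      then show ?thesis using IT(3) state(5) by (auto simp: unread_snoc)
    qed
    ultimately show "scan_state d n (w @ [x], delete_empty ((E \<union> I) # T))"
      using x state(1,2) by (auto simp: scan_state_def q set_delete_empty unread_def)
  next
    fix J y z a b
    assume J: "J \<in> set (delete_empty ((E \<union> I) # T))" "y \<in> J" "z \<in> J"
      and ab: "trigger_followed_by d w a [b]" "a < y" "y < b" "b < z"
    have "y \<notin> E" "z \<notin> E" using ab q_le[OF ab(1)] E_less by fastforce+
    then obtain J' where "J' \<in> set S" "y \<in> J'" "z \<in> J'"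
      using J IT(1,2) by (auto simp: set_delete_empty)
    then show False using scan_invariant.block_not_separated[OF inv] ab by blast
  next
    have "separated d w (E \<union> I) J" if sep: "separated d w I J" for J
    proof -
      from sep obtain a b where ab: "trigger_followed_by d w a [b]" "\<exists>y\<in>I. a < y"
        "\<forall>y\<in>I. y < b" "\<forall>z\<in>J. b < z"
        unfolding separated_def by blast
      then have "?q < b" using q_le[OF ab(1)] by fastforce
      then show ?thesis unfolding separated_def using ab E_less
        by (intro exI[of _ a] exI[of _ b]) (auto intro: less_trans)
    qed
    then have "sorted_wrt (separated d w) ((E \<union> I) # T)"
      using sorted_IT[OF scan_invariant.blocks_separated[OF inv]] by auto
    then show "sorted_wrt (separated d w) (delete_empty ((E \<union> I) # T))"
      unfolding delete_empty_def by (rule sorted_wrt_filter)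
  qed
qed

lemma scan_invariant_non_trigger:
  assumes inv: "scan_invariant d n w S" and d: "d \<ge> 1" and x: "x \<in> unread n w"
    and "\<not> trigger d (w @ [x]) x"
  shows "scan_invariant d n (w @ [x]) S"
proof -
  let ?q = "least_trigger d n w"
  note state = scan_stateD[OF scan_invariant.state[OF inv]]
  have le: "x < n + d" using x d by (auto simp: unread_def)
  have less: "x < ?q"
  proof (rule ccontr)
    assume "\<not> x < ?q"
    moreover have "?q \<noteq> x" using least_trigger_read[OF d] x by blast
    ultimately have "?q < x" by simp
    moreover from this have "trigger d w ?q" using le by (intro trigger_least_trigger) simp
    ultimately show False using trigger_greater assms(4) by blast
  qed
  have q: "least_trigger d n (w @ [x]) = ?q"
    using assms(4) le by (simp add: least_trigger_snoc)
  show ?thesis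
  proof (rule scan_invariant_below_least_trigger[OF inv x less])
    have "{y \<in> unread n (w @ [x]). ?q < y} = {y \<in> unread n w. ?q < y}"
      using less by (auto simp: unread_snoc)
    then show "scan_state d n (w @ [x], S)"
      using x state by (auto simp: scan_state_def q unread_def)
  qed (fact scan_invariant.block_not_separated[OF inv] scan_invariant.blocks_separated[OF inv])+
qed

text \<open>The letter \<open>x\<close> can take any of the roles \<open>b\<close>, \<open>c\<close>, \<open>y\<close>. As \<open>y\<close>, it would
complete a pattern, which the invariant excludes for unread letters. As \<open>b\<close>, with the least
trigger as \<open>a\<close>, it separates the two parts of the first block and neither part in itself. As
\<open>c\<close>, it would leave an unread \<open>y\<close> with \<open>a < y < b < x\<close>; such a \<open>y\<close> is above
the least trigger and below \<open>x\<close>, thus in the first block, which \<open>b\<close> would separate.\<close>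

lemma scan_invariant_split:
  assumes inv: "scan_invariant d n w (I # T)" and d: "d \<ge> 1" and x: "x \<in> unread n w"
    and greater: "least_trigger d n w < x" and xI: "x \<in> I"
  shows "scan_invariant d n (w @ [x]) (delete_empty ({y \<in> I. y < x} # {y \<in> I. x < y} # T))"
proof -
  let ?q = "least_trigger d n w" and ?L = "{y \<in> I. y < x}" and ?R = "{y \<in> I. x < y}"
  note state = scan_stateD[OF scan_invariant.state[OF inv]]
  have le: "x < n + d" using x d by (auto simp: unread_def)
  have q: "least_trigger d n (w @ [x]) = ?q"
    using greater le by (simp add: least_trigger_snoc)
  have trig: "trigger d w ?q" using le greater by (intro trigger_least_trigger) simp
  have q_le: "?q \<le> a" if "trigger_followed_by d w a vs" for a vs
    using followed_by_imp_trigger[OF that] least_trigger_le by blast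
  have above: "?q < y" if "J \<in> set (I # T)" "y \<in> J" for J y
    using that state(5) by blast
  have I_less: "y < z" if "y \<in> I" "z \<in> J" "J \<in> set T" for y z J
    using that state(4) by auto
  have below: "y \<in> I" if "y \<in> unread n w" "?q < y" "y < x" for y
  proof -
    have "y \<in> \<Union> (set (I # T))" using that state(5) by blast
    then show ?thesis using I_less[OF xI] that(3) by (auto dest: less_asym)
  qed
  have "sorted_wrt (\<lambda>I J. \<forall>a\<in>I. \<forall>b\<in>J. a < b) (?L # ?R # T)"
    using state(4) by auto
  then have "sorted_wrt (\<lambda>I J. \<forall>a\<in>I. \<forall>b\<in>J. a < b) (delete_empty (?L # ?R # T))"
    unfolding delete_empty_def by (rule sorted_wrt_filter)
  moreover have "?L \<union> ?R \<union> \<Union> (set T) = {y \<in> unread n (w @ [x]). ?q < y}"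
  proof -
    have "x \<notin> \<Union> (set T)" using I_less[OF xI] by blast
    then have "?L \<union> ?R \<union> \<Union> (set T) = \<Union> (set (I # T)) - {x}"
      by (auto simp: neq_iff)
    then show ?thesis using state(5) by (auto simp: unread_snoc)
  qed
  ultimately have st: "scan_state d n (w @ [x], delete_empty (?L # ?R # T))"
    unfolding scan_state_def prod.case q
  proof (intro conjI)
    show "distinct (w @ [x])" "set (w @ [x]) \<subseteq> {1..n}"
      using x state(1,2) by (auto simp: unread_def)
    assume un: "?L \<union> ?R \<union> \<Union> (set T) = {y \<in> unread n (w @ [x]). ?q < y}"
    have "\<Union> (set (delete_empty (?L # ?R # T))) = ?L \<union> ?R \<union> \<Union> (set T)"
      unfolding Union_delete_empty by (simp add: Un_assoc)
    then show "\<Union> (set (delete_empty (?L # ?R # T))) = {y \<in> unread n (w @ [x]). ?q < y}"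
      using un by simp
    show "\<forall>J\<in>set (delete_empty (?L # ?R # T)). J \<noteq> {}" by (simp add: set_delete_empty)
  qed
  have old: False if "trigger_followed_by d w a [b]" "a < y" "y < b" "b < z"
    "y \<in> J" "z \<in> J" "J \<in> set (I # T)" for a b y z J
    by (rule scan_invariant.block_not_separated[OF inv that(7,5,6,1-4)])
  have unread_le: False if "y \<in> unread n w" "trigger_followed_by d w a [b]" "a < y" "y < b" "b < x" for y a b
  proof -
    have "?q < y" "y < x" using q_le[OF that(2)] that by auto
    then have "y \<in> I" using below that by blast
    then show False using old[OF that(2-5) _ xI] by simp
  qed
  have blocks: False if J: "J \<in> set (delete_empty (?L # ?R # T))" "y \<in> J" "z \<in> J"
    and ab: "trigger_followed_by d (w @ [x]) a [b]" "a < y" "y < b" "b < z" for J y z a b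
  proof -
    obtain J' where J': "J' \<in> set (I # T)" "y \<in> J'" "z \<in> J'"
      using J by (auto simp: set_delete_empty)
    show False
      using ab(1) unfolding followed_by_one_snoc_iff
    proof
      assume "trigger_followed_by d w a [b]"
      then show False using old ab J' by blast
    next
      assume "b = x \<and> trigger_followed_by d w a []"
      then have "y < x" "x < z" using ab by auto
      then show False using J I_less[OF xI] by (auto simp: set_delete_empty dest: less_asym)
    qed
  qed
  have sep_new: "trigger_followed_by d (w @ [x]) ?q [x]"
    using trig by (simp add: followed_by_one_snoc_iff trigger_iff_followed_by_Nil)
  have sepL: "separated d (w @ [x]) ?L J" if "?L \<noteq> {}" "\<forall>z\<in>J. x < z" for J
    unfolding separated_def using that above sep_new
    by (intro exI[of _ ?q] exI[of _ x]) auto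
  have sepR: "separated d (w @ [x]) ?R J" if "?R \<noteq> {}" "separated d w I J" for J
  proof -
    from that(2) obtain a b y where ab: "trigger_followed_by d w a [b]" "y \<in> I" "a < y"
      "\<forall>y\<in>I. y < b" "\<forall>z\<in>J. b < z"
      unfolding separated_def by blast
    \<comment> \<open>If the old witness \<open>y\<close> is not in the upper part, any letter of that part is even larger.\<close>
    have "\<exists>y\<in>?R. a < y"
    proof (cases "x < y")
      case False
      then show ?thesis using that(1) ab(3) by fastforce
    qed (use ab in blast)
    then have "separated d w ?R J" unfolding separated_def using ab
      by (intro exI[of _ a] exI[of _ b]) auto
    then show ?thesis by (rule separated_snoc)
  qed
  have "sorted_wrt (separated d w) (I # T)" by (rule scan_invariant.blocks_separated[OF inv])
  then have sep: "\<forall>J\<in>set T. separated d w I J" "sorted_wrt (separated d w) T" by auto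
  have "sorted_wrt (\<lambda>I J. I \<noteq> {} \<longrightarrow> separated d (w @ [x]) I J) (?L # ?R # T)"
    unfolding sorted_wrt.simps
  proof (intro conjI ballI impI)
    show "separated d (w @ [x]) ?L J" if "J \<in> set (?R # T)" "?L \<noteq> {}" for J
      using that I_less[OF xI] by (intro sepL) auto
    show "separated d (w @ [x]) ?R J" if "J \<in> set T" "?R \<noteq> {}" for J
      using that sep by (intro sepR) auto
    show "sorted_wrt (\<lambda>I J. I \<noteq> {} \<longrightarrow> separated d (w @ [x]) I J) T"
      using sep(2) by (rule sorted_wrt_mono_rel[rotated]) (simp add: separated_snoc)
  qed
  then have sorted: "sorted_wrt (separated d (w @ [x])) (delete_empty (?L # ?R # T))"
    by (rule sorted_wrt_delete_empty)
  show ?thesis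
  proof
    fix a y b c
    assume "trigger_followed_by d (w @ [x]) a [b, c, y]" "a < y" "y < b" "b < c"
    then show False
      unfolding followed_by_three_snoc_iff
      using scan_invariant.pattern_free[OF inv] scan_invariant.unread_completes_no_pattern[OF inv x]
      by metis
  next
    fix a y b c
    assume "y \<in> unread n (w @ [x])"
      and "trigger_followed_by d (w @ [x]) a [b, c]" "a < y" "y < b" "b < c"
    then show False
      unfolding followed_by_two_snoc_iff unread_snoc
      using scan_invariant.unread_completes_no_pattern[OF inv] unread_le by (metis DiffD1)
  qed (fact st blocks sorted)+
qed

lemma legal_move_scan_invariant:
  assumes "legal_move d n x (w, S) (w', S')" "scan_invariant d n w S" "d \<ge> 1"
  shows "scan_invariant d n w' S'"
  using assms(1)
proof cases
  case merger
  with assms show ?thesis using scan_invariant_merger[OF _ assms(3)] by simp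
next
  case split
  with assms show ?thesis using scan_invariant_split[OF _ assms(3)] by simp
next
  case non_trigger
  with assms show ?thesis using scan_invariant_non_trigger[OF _ assms(3)] by simp
qed

lemma reachable_scan_invariant:
  assumes "d \<ge> 1" "reachable d n (w, S)"
  shows "scan_invariant d n w S"
proof -
  have "case_prod (scan_invariant d n) s" if "reachable d n s" for s
    using that unfolding reachable_def
  proof (induction rule: rtranclp_induct)
    case base
    then show ?case by (simp add: scan_invariant_Nil)
  next
    case (step s t)
    then show ?case
      using legal_move_scan_invariant[of d n _ "fst s" "snd s" "fst t" "snd t"] assms(1)
      by (metis case_prod_unfold prod.collapse)
  qed
  from this[OF assms(2)] show ?thesis by simp
qed

lemma scan_invariant_avoids:
  assumes "d \<ge> 1" "scan_invariant d n w S"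
  shows "avoids w (beta d)"
  unfolding avoids_def contains_beta_iff[OF assms(1)]
  by (auto dest: scan_invariant.pattern_free[OF assms(2)])

section \<open>Illegal reads and extension of legal words\<close>

text \<open>Below the least trigger either the merger or the non-trigger move applies, and in the first
block either the split or the non-trigger move applies.\<close>

lemma illegal_read_not_in_first_set:
  assumes inv: "scan_invariant d n w S" and d: "d \<ge> 1" and x: "x \<in> unread n w"
    and illegal: "\<not> legal_read d n (w, S) x"
  obtains I T where "S = I # T" "x \<in> \<Union> (set T)"
proof -
  note state = scan_invariant.state[OF inv]
  have trig: "trigger d (w @ [x]) x"
    using illegal legal_move.non_trigger[OF state x] unfolding legal_read_def by blast
  have "\<not> x < least_trigger d n w"
    using illegal legal_move.merger[OF state x trig] unfolding legal_read_def by blast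
  moreover have "x \<noteq> least_trigger d n w" using least_trigger_read[OF d] x by blast
  ultimately have greater: "least_trigger d n w < x" by simp
  then have in_stack: "x \<in> \<Union> (set S)" using scan_stateD(5)[OF state] x by blast
  then obtain I T where S: "S = I # T" by (cases S) auto
  have "x \<notin> I"
    using illegal legal_move.split[OF state x trig greater S] unfolding legal_read_def by blast
  then show thesis using in_stack S that by auto
qed

text \<open>The letter \<open>x\<close> is in a later block, so the pair \<open>a\<close>, \<open>b\<close> that separates it from the first
block comes with an unread \<open>y\<close> between \<open>a\<close> and \<open>b\<close>. In the permutation \<open>y\<close> comes
after \<open>x\<close> and completes the pattern.\<close>

lemma illegal_read_blocks:
  assumes inv: "scan_invariant d n w S" and d: "d \<ge> 1" and x: "x \<in> unread n w"
    and illegal: "\<not> legal_read d n (w, S) x"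
    and \<pi>: "\<pi> \<in> permutations_of_set {1..n}" "prefix (w @ [x]) \<pi>"
  shows "contains \<pi> (beta d)"
proof -
  from illegal_read_not_in_first_set[OF inv d x illegal]
  obtain I T J where S: "S = I # T" and J: "J \<in> set T" "x \<in> J" by blast
  have "separated d w I J" using scan_invariant.blocks_separated[OF inv] S J by auto
  then obtain a b y where ab: "trigger_followed_by d w a [b]" "y \<in> I" "a < y" "y < b" "b < x"
    unfolding separated_def using J by blast
  obtain v where v: "\<pi> = (w @ [x]) @ v" using \<pi>(2) by (auto simp: prefix_def)
  have "y \<in> unread n w" using scan_stateD(5)[OF scan_invariant.state[OF inv]] S ab(2) by auto
  then have "y \<in> set \<pi>" "y \<notin> set w"
    using permutations_of_setD(1)[OF \<pi>(1)] by (simp_all add: unread_def)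
  then have "y \<in> set v" using v ab(4,5) by auto
  then have "subseq [y] v" by (simp add: subseq_singleton_left)
  moreover have "trigger_followed_by d (w @ [x]) a [b, x]"
    using ab(1) by (simp add: followed_by_two_snoc_iff)
  ultimately have "trigger_followed_by d \<pi> a [b, x, y]"
    using followed_by_append[of d "w @ [x]" a "[b, x]" "[y]" v] by (simp add: v)
  then show ?thesis unfolding contains_beta_iff[OF d] using ab(3-5) by (intro exI conjI)
qed

lemma legal_word_snoc:
  assumes "reachable d n (w, S)" "legal_read d n (w, S) x"
  shows "legal_word d n (w @ [x])"
proof -
  obtain s' where move: "legal_move d n x (w, S) s'" using assms(2) by (auto simp: legal_read_def)
  then obtain S' where "s' = (w @ [x], S')"
    using legal_move_word[OF move] by (cases s') auto
  with move have "\<exists>y. legal_move d n y (w, S) (w @ [x], S')" by blast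
  with assms(1) have "reachable d n (w @ [x], S')"
    unfolding reachable_def by (rule rtranclp.rtrancl_into_rtrancl)
  then show ?thesis by (auto simp: legal_word_def)
qed

text \<open>An illegal read needs a nonempty first block, whose letters are themselves legal to
read. So the scan never gets stuck.\<close>

lemma legal_read_exists:
  assumes inv: "scan_invariant d n w S" and d: "d \<ge> 1" and "unread n w \<noteq> {}"
  shows "\<exists>x\<in>unread n w. legal_read d n (w, S) x"
proof (rule ccontr)
  assume none: "\<not> ?thesis"
  then obtain I T where S: "S = I # T"
    using assms(3) illegal_read_not_in_first_set[OF inv d] by blast
  note state = scan_stateD[OF scan_invariant.state[OF inv]]
  obtain y where y: "y \<in> I" using state(3) S by fastforce
  then have "y \<in> unread n w" using state(5) S by auto
  with none illegal_read_not_in_first_set[OF inv d] S have "y \<in> \<Union> (set T)" by blast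
  then show False using state(4) S y by auto
qed

lemma legal_word_extends:
  assumes d: "d \<ge> 1" and "legal_word d n w"
  shows "\<exists>\<pi>\<in>permutations_of_set {1..n}. legal_word d n \<pi> \<and> prefix w \<pi>"
  using assms(2)
proof (induction "card (unread n w)" arbitrary: w rule: less_induct)
  case less
  then obtain S where S: "reachable d n (w, S)" by (auto simp: legal_word_def)
  note inv = reachable_scan_invariant[OF d S]
  show ?case
  proof (cases "unread n w = {}")
    case True
    then have "set w = {1..n}"
      using scan_stateD(2)[OF scan_invariant.state[OF inv]] unfolding unread_def by blast
    then have "w \<in> permutations_of_set {1..n}"
      using scan_stateD(1)[OF scan_invariant.state[OF inv]] by (rule permutations_of_setI)
    then show ?thesis using less.prems prefix_order.refl by blast
  next
    case False
    then obtain x where x: "x \<in> unread n w" "legal_read d n (w, S) x"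
      using legal_read_exists[OF inv d] by blast
    have "card (unread n (w @ [x])) < card (unread n w)"
      unfolding unread_snoc using x(1) by (intro card_Diff1_less) (auto simp: unread_def)
    from less.hyps[OF this legal_word_snoc[OF S x(2)]] obtain \<pi>
      where "\<pi> \<in> permutations_of_set {1..n}" "legal_word d n \<pi>" "prefix (w @ [x]) \<pi>" by blast
    moreover from this(3) have "prefix w \<pi>" by (rule append_prefixD)
    ultimately show ?thesis by blast
  qed
qed

lemma prefix_of_Av_legal:
  assumes d: "d \<ge> 1" and \<pi>: "\<pi> \<in> Av n (beta d)" and "prefix w \<pi>"
  shows "legal_word d n w"
  using assms(3)
proof (induction w rule: rev_induct)
  case Nil
  then show ?case by (auto simp: legal_word_def reachable_def)
next
  case (snoc x w)
  then obtain S where S: "reachable d n (w, S)"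
    by (auto simp: legal_word_def dest: append_prefixD)
  have perm: "\<pi> \<in> permutations_of_set {1..n}" "avoids \<pi> (beta d)"
    using \<pi> by (auto simp: Av_def)
  then have "x \<in> unread n w"
    using snoc.prems permutations_of_setD[OF perm(1)] by (auto simp: unread_def prefix_def)
  then have "legal_read d n (w, S) x"
    using illegal_read_blocks[OF reachable_scan_invariant[OF d S] d _ _ perm(1) snoc.prems] perm(2)
    unfolding avoids_def by blast
  with S show ?case by (rule legal_word_snoc)
qed

theorem proposition2p8:
  fixes d n :: nat
  assumes "d \<ge> 1"
  shows "(\<forall>\<sigma>. legal_word d n \<sigma> \<longrightarrow> avoids \<sigma> (beta d)) \<and>
    (\<forall>\<sigma> x. legal_word d n \<sigma> \<and> x \<in> unread n \<sigma> \<and> \<not> legal_read d n (\<sigma>, stack_of d n \<sigma>) x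
        \<longrightarrow> \<not> (\<exists>\<pi> \<in> Av n (beta d). prefix (\<sigma> @ [x]) \<pi>)) \<and>
    (\<forall>w. legal_word d n w \<longleftrightarrow> (\<exists>\<pi> \<in> Av n (beta d). prefix w \<pi>)) \<and>
    Av n (beta d) = {\<pi> \<in> permutations_of_set {1..n}. legal_word d n \<pi>}"
proof -
  have a: "avoids \<sigma> (beta d)" if "legal_word d n \<sigma>" for \<sigma>
  proof -
    from that obtain S where "reachable d n (\<sigma>, S)" by (auto simp: legal_word_def)
    from scan_invariant_avoids[OF assms reachable_scan_invariant[OF assms this]] show ?thesis .
  qed
  have b: "\<not> (\<exists>\<pi> \<in> Av n (beta d). prefix (\<sigma> @ [x]) \<pi>)"
    if legal: "legal_word d n \<sigma>" and x: "x \<in> unread n \<sigma>"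
      and illegal: "\<not> legal_read d n (\<sigma>, stack_of d n \<sigma>) x" for \<sigma> x
  proof -
    obtain S where S: "reachable d n (\<sigma>, S)" using legal by (auto simp: legal_word_def)
    show ?thesis
    proof
      assume "\<exists>\<pi> \<in> Av n (beta d). prefix (\<sigma> @ [x]) \<pi>"
      then obtain \<pi> where \<pi>: "\<pi> \<in> permutations_of_set {1..n}" "avoids \<pi> (beta d)"
        "prefix (\<sigma> @ [x]) \<pi>"
        by (auto simp: Av_def)
      from illegal_read_blocks[OF reachable_scan_invariant[OF assms S] assms x
          illegal[unfolded stack_of_eq[OF S]] \<pi>(1,3)] \<pi>(2)
      show False by (simp add: avoids_def)
    qed
  qed
  have Av_iff: "\<pi> \<in> Av n (beta d) \<longleftrightarrow> \<pi> \<in> permutations_of_set {1..n} \<and> legal_word d n \<pi>" for \<pi>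
  proof
    assume \<pi>: "\<pi> \<in> Av n (beta d)"
    then have "\<pi> \<in> permutations_of_set {1..n}" by (simp add: Av_def)
    moreover have "legal_word d n \<pi>"
      by (rule prefix_of_Av_legal[OF assms \<pi> prefix_order.refl])
    ultimately show "\<pi> \<in> permutations_of_set {1..n} \<and> legal_word d n \<pi>" ..
  next
    assume "\<pi> \<in> permutations_of_set {1..n} \<and> legal_word d n \<pi>"
    then show "\<pi> \<in> Av n (beta d)" using a by (simp add: Av_def)
  qed
  have c: "legal_word d n w \<longleftrightarrow> (\<exists>\<pi> \<in> Av n (beta d). prefix w \<pi>)" for w
  proof
    assume "legal_word d n w"
    from legal_word_extends[OF assms this] show "\<exists>\<pi> \<in> Av n (beta d). prefix w \<pi>"
      using Av_iff by blast
  next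
    assume "\<exists>\<pi> \<in> Av n (beta d). prefix w \<pi>"
    then show "legal_word d n w" using prefix_of_Av_legal[OF assms] by blast
  qed
  have Av_eq: "Av n (beta d) = {\<pi> \<in> permutations_of_set {1..n}. legal_word d n \<pi>}"
    unfolding set_eq_iff mem_Collect_eq by (simp add: Av_iff)
  show ?thesis
  proof (intro conjI allI impI)
    fix \<sigma> x
    assume "legal_word d n \<sigma> \<and> x \<in> unread n \<sigma> \<and> \<not> legal_read d n (\<sigma>, stack_of d n \<sigma>) x"
    then show "\<not> (\<exists>\<pi> \<in> Av n (beta d). prefix (\<sigma> @ [x]) \<pi>)"
      by (elim conjE) (rule b)
  qed (fact a c Av_eq)+
qed

end
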